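(* There is a one-to-one correspondence between strict $2$-term averaging $L_\infty$-algebras and crossed modules of averaging Lie algebras.
   Context: Everything is over a field of characteristic zero. An averaging operator on a Lie algebra $\mathfrak{g}$ is a linear map $P:\mathfrak{g}\to\mathfrak{g}$ with $[P(x),P(y)]_{\mathfrak{g}}=P([P(x),y]_{\mathfrak{g}})$ for all $x,y$; an averaging Lie algebra $\mathfrak{g}_P$ is a Lie algebra $\mathfrak{g}$ with an averaging operator $P$. A morphism $\mathfrak{g}_P\to\mathfrak{g}'_{P'}$ is a Lie algebra homomorphism $\tau$ with $P'\circ\tau=\tau\circ P$. A representation $V_Q$ of $\mathfrak{g}_P$ is a Lie algebra representation $\psi:\mathfrak{g}\to\mathrm{End}(V)$ with a linear map $Q:V\to V$ such that $\psi_{P(x)}Q(v)=Q(\psi_{P(x)}v)=Q(\psi_xQ(v))$ for all $x\in\mathfrak{g},v\in V$. A crossed module of averaging Lie algebras is a quadruple $\big((\mathfrak{g}_1)_{P_1},(\mathfrak{g}_0)_{P_0},d,\rho\big)$ where $(\mathfrak{g}_1)_{P_1}$, $(\mathfrak{g}_0)_{P_0}$ are averaging Lie algebras, $d:(\mathfrak{g}_1)_{P_1}\to(\mathfrak{g}_0)_{P_0}$ is a morphism of averaging Lie algebras and $\rho:\mathfrak{g}_0\to\mathrm{Der}(\mathfrak{g}_1)$ is a Lie algebra homomorphism making $(\mathfrak{g}_1)_{P_1}$ (the vector space $\mathfrak{g}_1$ with the linear map $P_1$) a representation of $(\mathfrak{g}_0)_{P_0}$, such that $d(\rho_xh)=[x,dh]_{\mathfrak{g}_0}$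 and $\rho_{dh}k=[h,k]_{\mathfrak{g}_1}$ for all $x\in\mathfrak{g}_0$, $h,k\in\mathfrak{g}_1$. A $2$-term $L_\infty$-algebra $(\mathfrak{g}_1\xrightarrow{d}\mathfrak{g}_0,\llbracket\,,\,\rrbracket,l_3)$ consists of a $2$-term chain complex, i.e. a linear map $d:\mathfrak{g}_1\to\mathfrak{g}_0$, bilinear maps $\llbracket\,,\,\rrbracket:\mathfrak{g}_i\times\mathfrak{g}_j\to\mathfrak{g}_{i+j}$ ($0\le i,j\le1$, with $\mathfrak{g}_2=0$) and a skew-symmetric trilinear map $l_3:\mathfrak{g}_0\times\mathfrak{g}_0\times\mathfrak{g}_0\to\mathfrak{g}_1$ such that for all $w,x,y,z\in\mathfrak{g}_0$, $h,k\in\mathfrak{g}_1$: (L1) $\llbracket x,y\rrbracket=-\llbracket y,x\rrbracket$; (L2) $\llbracket x,h\rrbracket=-\llbracket h,x\rrbracket$; (L3) $\llbracket h,k\rrbracket=0$; (L4) $d\llbracket x,h\rrbracket=\llbracket x,dh\rrbracket$; (L5) $\llbracket dh,k\rrbracket=\llbracket h,dk\rrbracket$; (L6) $d(l_3(x,y,z))=\llbracket x,\llbracket y,z\rrbracket\rrbracket+\llbracket y,\llbracket z,x\rrbracket\rrbracket+\llbracket z,\llbracket x,y\rrbracket\rrbracket$; (L7) $l_3(x,y,dh)=\llbracket x,\llbracket y,h\rrbracket\rrbracket+\llbracket y,\llbracket h,x\rrbracket\rrbracket+\llbracket h,\llbracket x,y\rrbracket\rrbracket$; (L8) $\llbracket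 w,l_3(x,y,z)\rrbracket-\llbracket x,l_3(w,y,z)\rrbracket+\llbracket y,l_3(w,x,z)\rrbracket-\llbracket z,l_3(w,x,y)\rrbracket=l_3(\llbracket w,x\rrbracket,y,z)-l_3(\llbracket w,y\rrbracket,x,z)+l_3(\llbracket w,z\rrbracket,x,y)+l_3(\llbracket x,y\rrbracket,w,z)-l_3(\llbracket x,z\rrbracket,w,y)+l_3(\llbracket y,z\rrbracket,w,x)$. A homotopy averaging operator on it is a triple $(P_0,P_1,P_2)$ of linear maps $P_0:\mathfrak{g}_0\to\mathfrak{g}_0$, $P_1:\mathfrak{g}_1\to\mathfrak{g}_1$ and a skew-symmetric bilinear map $P_2:\mathfrak{g}_0\times\mathfrak{g}_0\to\mathfrak{g}_1$ such that for all $x,y,z\in\mathfrak{g}_0$, $h\in\mathfrak{g}_1$: (A1) $P_0\circ d=d\circ P_1$; (A2) $d(P_2(x,y))=P_0(\llbracket P_0(x),y\rrbracket)-\llbracket P_0(x),P_0(y)\rrbracket$; (A3) $P_2(x,dh)=P_1(\llbracket P_0(x),h\rrbracket)-\llbracket P_0(x),P_1(h)\rrbracket=P_1(\llbracket x,P_1(h)\rrbracket)-\llbracket P_0(x),P_1(h)\rrbracket$; (A4) $\llbracket P_0(x),P_2(y,z)\rrbracket-\llbracket P_0(y),P_2(x,z)\rrbracket+\llbracket P_0(z),P_2(x,y)\rrbracket-P_1\llbracket z,P_2(x,y)\rrbracket-P_2(\llbracket P_0(x),y\rrbracket,z)-P_2(y,\llbracket P_0(x),z\rrbracket)+P_2(x,\llbracket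 P_0(y),z\rrbracket)=l_3(P_0(x),P_0(y),P_0(z))-P_1l_3(P_0(x),P_0(y),z)$. A $2$-term averaging $L_\infty$-algebra is a $2$-term $L_\infty$-algebra with a homotopy averaging operator, written $(\mathfrak{g}_1\xrightarrow{d}\mathfrak{g}_0,\llbracket\,,\,\rrbracket,l_3,P_0,P_1,P_2)$. It is strict if $l_3=0$ and $P_2=0$. *)

theory Defs
  imports Complex_Main
begin

text \<open>
  A vector space over a field \<open>'k\<close> of characteristic zero is a type of class \<open>ab_group_add\<close> with
  a scalar multiplication satisfying the locale \<^locale>\<open>vector_space\<close>.
\<close>

definition bilinear_map ::
  "('k::field \<Rightarrow> 'a::ab_group_add \<Rightarrow> 'a) \<Rightarrow> ('k \<Rightarrow> 'b::ab_group_add \<Rightarrow> 'b) \<Rightarrow>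
   ('k \<Rightarrow> 'c::ab_group_add \<Rightarrow> 'c) \<Rightarrow> ('a \<Rightarrow> 'b \<Rightarrow> 'c) \<Rightarrow> bool"
  where "bilinear_map sa sb sc f \<longleftrightarrow>
    (\<forall>x. Vector_Spaces.linear sb sc (\<lambda>y. f x y)) \<and>
    (\<forall>y. Vector_Spaces.linear sa sc (\<lambda>x. f x y))"

definition trilinear_map ::
  "('k::field \<Rightarrow> 'a::ab_group_add \<Rightarrow> 'a) \<Rightarrow> ('k \<Rightarrow> 'b::ab_group_add \<Rightarrow> 'b) \<Rightarrow>
   ('a \<Rightarrow> 'a \<Rightarrow> 'a \<Rightarrow> 'b) \<Rightarrow> bool"
  where "trilinear_map sa sb f \<longleftrightarrow>
    (\<forall>y z. Vector_Spaces.linear sa sb (\<lambda>x. f x y z)) \<and>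
    (\<forall>x z. Vector_Spaces.linear sa sb (\<lambda>y. f x y z)) \<and>
    (\<forall>x y. Vector_Spaces.linear sa sb (\<lambda>z. f x y z))"

subsection \<open>Averaging Lie algebras and their representations\<close>

locale lie_algebra = vector_space scale
  for scale :: "'k::field_char_0 \<Rightarrow> 'a::ab_group_add \<Rightarrow> 'a" +
  fixes bracket :: "'a \<Rightarrow> 'a \<Rightarrow> 'a"
  assumes bilinear: "bilinear_map scale scale scale bracket"
    and alternating: "bracket x x = 0"
    and jacobi: "bracket x (bracket y z) + bracket y (bracket z x) + bracket z (bracket x y) = 0"

locale averaging_lie_algebra = lie_algebra scale bracket
  for scale :: "'k::field_char_0 \<Rightarrow> 'a::ab_group_add \<Rightarrow> 'a" and bracket +
  fixes P :: "'a \<Rightarrow> 'a"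
  assumes linear_P: "Vector_Spaces.linear scale scale P"
    and averaging: "bracket (P x) (P y) = P (bracket (P x) y)"

locale averaging_lie_algebra_hom =
  source: averaging_lie_algebra s b P + target: averaging_lie_algebra s' b' P'
  for s :: "'k::field_char_0 \<Rightarrow> 'a::ab_group_add \<Rightarrow> 'a" and b P
    and s' :: "'k \<Rightarrow> 'b::ab_group_add \<Rightarrow> 'b" and b' P' +
  fixes \<tau> :: "'a \<Rightarrow> 'b"
  assumes linear_hom: "Vector_Spaces.linear s s' \<tau>"
    and bracket_hom: "\<tau> (b x y) = b' (\<tau> x) (\<tau> y)"
    and commute: "P' \<circ> \<tau> = \<tau> \<circ> P"

text \<open>
  The target of \<open>\<psi>\<close> is \<open>End(V)\<close> with the commutator bracket; its linear structure is pointwise, so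
  linearity of \<open>\<psi>\<close> and of all \<open>\<psi> x\<close> amounts to bilinearity of the uncurried action.
\<close>

locale lie_algebra_representation = lie_algebra s b + V: vector_space sV
  for s :: "'k::field_char_0 \<Rightarrow> 'a::ab_group_add \<Rightarrow> 'a" and b
    and sV :: "'k \<Rightarrow> 'v::ab_group_add \<Rightarrow> 'v" +
  fixes \<psi> :: "'a \<Rightarrow> 'v \<Rightarrow> 'v"
  assumes bilinear_action: "bilinear_map s sV sV \<psi>"
    and action_bracket: "\<psi> (b x y) v = \<psi> x (\<psi> y v) - \<psi> y (\<psi> x v)"

locale averaging_representation =
  averaging_lie_algebra s b P + lie_algebra_representation s b sV \<psi>
  for s :: "'k::field_char_0 \<Rightarrow> 'a::ab_group_add \<Rightarrow> 'a" and b P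
    and sV :: "'k \<Rightarrow> 'v::ab_group_add \<Rightarrow> 'v" and \<psi> +
  fixes Q :: "'v \<Rightarrow> 'v"
  assumes linear_Q: "Vector_Spaces.linear sV sV Q"
    and averaging_action1: "\<psi> (P x) (Q v) = Q (\<psi> (P x) v)"
    and averaging_action2: "Q (\<psi> (P x) v) = Q (\<psi> x (Q v))"

definition lie_derivation ::
  "('k::field_char_0 \<Rightarrow> 'a::ab_group_add \<Rightarrow> 'a) \<Rightarrow> ('a \<Rightarrow> 'a \<Rightarrow> 'a) \<Rightarrow> ('a \<Rightarrow> 'a) \<Rightarrow> bool"
  where "lie_derivation s b D \<longleftrightarrow>
    Vector_Spaces.linear s s D \<and> (\<forall>h k. D (b h k) = b (D h) k + b h (D k))"

subsection \<open>Crossed modules of averaging Lie algebras\<close>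

record ('a, 'b) crossed_module_data =
  cm_bracket1 :: "'a \<Rightarrow> 'a \<Rightarrow> 'a"
  cm_avg1 :: "'a \<Rightarrow> 'a"
  cm_bracket0 :: "'b \<Rightarrow> 'b \<Rightarrow> 'b"
  cm_avg0 :: "'b \<Rightarrow> 'b"
  cm_diff :: "'a \<Rightarrow> 'b"
  cm_action :: "'b \<Rightarrow> 'a \<Rightarrow> 'a"

text \<open>
  The homomorphism property of \<open>\<rho> : \<gg>\<^sub>0 \<rightarrow> Der(\<gg>\<^sub>1)\<close> is part of
  \<open>averaging_representation\<close>, since \<open>Der(\<gg>\<^sub>1)\<close> is a Lie subalgebra of \<open>End(\<gg>\<^sub>1)\<close>.
\<close>

locale averaging_crossed_module =
  d: averaging_lie_algebra_hom s1 b1 P1 s0 b0 P0 d +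
  \<rho>: averaging_representation s0 b0 P0 s1 \<rho> P1
  for s1 :: "'k::field_char_0 \<Rightarrow> 'a::ab_group_add \<Rightarrow> 'a"
    and s0 :: "'k \<Rightarrow> 'b::ab_group_add \<Rightarrow> 'b"
    and b1 P1 b0 P0 d \<rho> +
  assumes derivation: "lie_derivation s1 b1 (\<rho> x)"
    and equivariance: "d (\<rho> x h) = b0 x (d h)"
    and peiffer: "\<rho> (d h) k = b1 h k"

definition is_averaging_crossed_module ::
  "('k::field_char_0 \<Rightarrow> 'a::ab_group_add \<Rightarrow> 'a) \<Rightarrow> ('k \<Rightarrow> 'b::ab_group_add \<Rightarrow> 'b) \<Rightarrow>
   ('a, 'b) crossed_module_data \<Rightarrow> bool"
  where "is_averaging_crossed_module s1 s0 X \<longleftrightarrow>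
    averaging_crossed_module s1 s0 (cm_bracket1 X) (cm_avg1 X) (cm_bracket0 X) (cm_avg0 X)
      (cm_diff X) (cm_action X)"

subsection \<open>2-term averaging L-infinity algebras\<close>

text \<open>
  \<open>lij\<close> is the component \<open>\<gg>\<^sub>i \<times> \<gg>\<^sub>j \<rightarrow> \<gg>\<^sub>i\<^sub>+\<^sub>j\<close> of the bracket. The space \<open>\<gg>\<^sub>2 = 0\<close> is
  realised as the zero subspace of \<open>\<gg>\<^sub>1\<close>, so that \<open>l11\<close> is the zero map by \<open>L3\<close>.
\<close>

locale two_term_L_infinity = g1: vector_space s1 + g0: vector_space s0
  for s1 :: "'k::field_char_0 \<Rightarrow> 'a::ab_group_add \<Rightarrow> 'a"
    and s0 :: "'k \<Rightarrow> 'b::ab_group_add \<Rightarrow> 'b" +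
  fixes d :: "'a \<Rightarrow> 'b"
    and l00 :: "'b \<Rightarrow> 'b \<Rightarrow> 'b"
    and l01 :: "'b \<Rightarrow> 'a \<Rightarrow> 'a"
    and l10 :: "'a \<Rightarrow> 'b \<Rightarrow> 'a"
    and l11 :: "'a \<Rightarrow> 'a \<Rightarrow> 'a"
    and l3 :: "'b \<Rightarrow> 'b \<Rightarrow> 'b \<Rightarrow> 'a"
  assumes linear_d: "Vector_Spaces.linear s1 s0 d"
    and bilinear_l00: "bilinear_map s0 s0 s0 l00"
    and bilinear_l01: "bilinear_map s0 s1 s1 l01"
    and bilinear_l10: "bilinear_map s1 s0 s1 l10"
    and bilinear_l11: "bilinear_map s1 s1 s1 l11"
    and trilinear_l3: "trilinear_map s0 s1 l3"
    and skew_l3: "l3 x y z = - l3 y x z" "l3 x y z = - l3 x z y"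
    and L1: "l00 x y = - l00 y x"
    and L2: "l01 x h = - l10 h x"
    and L3: "l11 h k = 0"
    and L4: "d (l01 x h) = l00 x (d h)"
    and L5: "l01 (d h) k = l10 h (d k)"
    and L6: "d (l3 x y z) = l00 x (l00 y z) + l00 y (l00 z x) + l00 z (l00 x y)"
    and L7: "l3 x y (d h) = l01 x (l01 y h) + l01 y (l10 h x) + l10 h (l00 x y)"
    and L8: "l01 w (l3 x y z) - l01 x (l3 w y z) + l01 y (l3 w x z) - l01 z (l3 w x y) =
      l3 (l00 w x) y z - l3 (l00 w y) x z + l3 (l00 w z) x y
      + l3 (l00 x y) w z - l3 (l00 x z) w y + l3 (l00 y z) w x"

locale two_term_averaging_L_infinity = two_term_L_infinity s1 s0 d l00 l01 l10 l11 l3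
  for s1 :: "'k::field_char_0 \<Rightarrow> 'a::ab_group_add \<Rightarrow> 'a"
    and s0 :: "'k \<Rightarrow> 'b::ab_group_add \<Rightarrow> 'b"
    and d l00 l01 l10 l11 l3 +
  fixes P0 :: "'b \<Rightarrow> 'b" and P1 :: "'a \<Rightarrow> 'a" and P2 :: "'b \<Rightarrow> 'b \<Rightarrow> 'a"
  assumes linear_P0: "Vector_Spaces.linear s0 s0 P0"
    and linear_P1: "Vector_Spaces.linear s1 s1 P1"
    and bilinear_P2: "bilinear_map s0 s0 s1 P2"
    and skew_P2: "P2 x y = - P2 y x"
    and A1: "P0 \<circ> d = d \<circ> P1"
    and A2: "d (P2 x y) = P0 (l00 (P0 x) y) - l00 (P0 x) (P0 y)"
    and A3: "P2 x (d h) = P1 (l01 (P0 x) h) - l01 (P0 x) (P1 h)"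
      "P1 (l01 (P0 x) h) - l01 (P0 x) (P1 h) = P1 (l01 x (P1 h)) - l01 (P0 x) (P1 h)"
    and A4: "l01 (P0 x) (P2 y z) - l01 (P0 y) (P2 x z) + l01 (P0 z) (P2 x y)
        - P1 (l01 z (P2 x y)) - P2 (l00 (P0 x) y) z - P2 y (l00 (P0 x) z) + P2 x (l00 (P0 y) z) =
      l3 (P0 x) (P0 y) (P0 z) - P1 (l3 (P0 x) (P0 y) z)"

record ('a, 'b) two_term_data =
  tt_diff :: "'a \<Rightarrow> 'b"
  tt_bracket00 :: "'b \<Rightarrow> 'b \<Rightarrow> 'b"
  tt_bracket01 :: "'b \<Rightarrow> 'a \<Rightarrow> 'a"
  tt_bracket10 :: "'a \<Rightarrow> 'b \<Rightarrow> 'a"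
  tt_bracket11 :: "'a \<Rightarrow> 'a \<Rightarrow> 'a"
  tt_l3 :: "'b \<Rightarrow> 'b \<Rightarrow> 'b \<Rightarrow> 'a"
  tt_avg0 :: "'b \<Rightarrow> 'b"
  tt_avg1 :: "'a \<Rightarrow> 'a"
  tt_avg2 :: "'b \<Rightarrow> 'b \<Rightarrow> 'a"

definition is_two_term_averaging_L_infinity ::
  "('k::field_char_0 \<Rightarrow> 'a::ab_group_add \<Rightarrow> 'a) \<Rightarrow> ('k \<Rightarrow> 'b::ab_group_add \<Rightarrow> 'b) \<Rightarrow>
   ('a, 'b) two_term_data \<Rightarrow> bool"
  where "is_two_term_averaging_L_infinity s1 s0 L \<longleftrightarrow>
    two_term_averaging_L_infinity s1 s0 (tt_diff L) (tt_bracket00 L) (tt_bracket01 L)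
      (tt_bracket10 L) (tt_bracket11 L) (tt_l3 L) (tt_avg0 L) (tt_avg1 L) (tt_avg2 L)"

definition strict :: "('a::ab_group_add, 'b) two_term_data \<Rightarrow> bool"
  where "strict L \<longleftrightarrow>
    (\<forall>x y z. tt_l3 L x y z = 0) \<and> (\<forall>x y. tt_avg2 L x y = 0)"

subsection \<open>The correspondence\<close>

text \<open>
  The Lie bracket on \<open>\<gg>\<^sub>1\<close> is the derived bracket, not the (zero) component \<open>tt_bracket11\<close>.
\<close>

definition crossed_module_of :: "('a, 'b) two_term_data \<Rightarrow> ('a, 'b) crossed_module_data"
  where "crossed_module_of L =
    \<lparr> cm_bracket1 = (\<lambda>h k. tt_bracket01 L (tt_diff L h) k),
      cm_avg1 = tt_avg1 L,
      cm_bracket0 = tt_bracket00 L,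
      cm_avg0 = tt_avg0 L,
      cm_diff = tt_diff L,
      cm_action = tt_bracket01 L \<rparr>"

end

theory Submission
  imports Defs
begin

text \<open>
  A strict structure has \<open>l3 = 0\<close> and \<open>P2 = 0\<close>, while \<open>l11 = 0\<close> by \<open>L3\<close> and \<open>l10\<close> is
  determined by \<open>l01\<close> through \<open>L2\<close>. What is left is \<open>d\<close>, \<open>l00\<close>, \<open>l01\<close>, \<open>P0\<close>, \<open>P1\<close>. These are
  exactly the data of a crossed module with the bracket of \<open>\<gg>\<^sub>1\<close> omitted, and that bracket is in
  turn forced by the Peiffer identity: \<open>[h, k] = \<rho>\<^bsub>dh\<^esub> k = l01 (d h) k\<close>. So the map
  \<^const>\<open>crossed_module_of\<close> only trades one set of determined components for another, and
  the content of the theorem is that the two lists of axioms on the common data agree.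

  Under this dictionary \<open>L6\<close> is the Jacobi identity of \<open>\<gg>\<^sub>0\<close>, and \<open>L4\<close> is equivariance of \<open>d\<close>.
  The axiom \<open>L5\<close> is skew-symmetry of the derived bracket, and \<open>L7\<close> says that \<open>\<rho>\<close> is a
  representation. Restricted to the image of \<open>d\<close>, the representation property becomes the Jacobi
  identity of \<open>\<gg>\<^sub>1\<close>; together with equivariance it shows that \<open>\<rho>\<close> acts by derivations. Likewise
  \<open>A1\<close> is compatibility of \<open>d\<close> with the averaging operators, \<open>A2\<close> is the averaging identity of
  \<open>\<gg>\<^sub>0\<close>, and \<open>A3\<close> consists of the conditions on an averaging representation, whose restriction
  to the image of \<open>d\<close> is the averaging identity of \<open>\<gg>\<^sub>1\<close>. The coherence axioms \<open>L8\<close> and \<open>A4\<close>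
  hold trivially, every term being a value of a zero map or a linear map applied to zero.

  The two directions are \<open>averaging_crossed_module_of_strict\<close> and
  \<open>strict_L_infinity_of_averaging_crossed_module\<close>.
\<close>

section \<open>Linear and bilinear maps\<close>

lemma linear_zero_map:
  assumes "vector_space sa" "vector_space sb"
  shows "Vector_Spaces.linear sa sb (\<lambda>_. 0)"
proof -
  interpret vector_space_pair sa sb
    using assms by (simp add: vector_space_pair_def)
  show ?thesis by (rule linear_zero)
qed

lemma linear_uminus:
  assumes "Vector_Spaces.linear sa sb f"
  shows "Vector_Spaces.linear sa sb (\<lambda>x. - f x)"
proof -
  interpret f: Vector_Spaces.linear sa sb f by (rule assms)
  interpret vector_space_pair sa sb by unfold_locales
  show ?thesis by (rule linear_compose_neg[OF assms])
qed

lemma linear_image_zero: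
  assumes "Vector_Spaces.linear sa sb f"
  shows "f 0 = 0"
proof -
  interpret f: Vector_Spaces.linear sa sb f by (rule assms)
  show ?thesis by (rule f.zero)
qed

lemma linear_image_uminus:
  assumes "Vector_Spaces.linear sa sb f"
  shows "f (- x) = - f x"
proof -
  interpret f: Vector_Spaces.linear sa sb f by (rule assms)
  show ?thesis by (rule f.neg)
qed

lemma bilinear_map_zero_map:
  assumes "vector_space sa" "vector_space sb" "vector_space sc"
  shows "bilinear_map sa sb sc (\<lambda>_ _. 0)"
  using assms by (simp add: bilinear_map_def linear_zero_map)

lemma bilinear_map_uminus_flip:
  assumes "bilinear_map sa sb sc f"
  shows "bilinear_map sb sa sc (\<lambda>y x. - f x y)"
  using assms by (simp add: bilinear_map_def linear_uminus)

lemma bilinear_map_compose_left: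
  assumes "bilinear_map sb sa sc f" "Vector_Spaces.linear sa' sb g"
  shows "bilinear_map sa' sa sc (\<lambda>x y. f (g x) y)"
  using assms Vector_Spaces.linear_compose[OF assms(2)]
  by (auto simp: bilinear_map_def o_def)

lemma bilinear_map_zero_right:
  assumes "bilinear_map sa sb sc f"
  shows "f x 0 = 0"
  using assms linear_image_zero[of sb sc "f x"] by (simp add: bilinear_map_def)

lemma bilinear_map_minus_right:
  assumes "bilinear_map sa sb sc f"
  shows "f x (- y) = - f x y"
  using assms linear_image_uminus[of sb sc "f x"] by (simp add: bilinear_map_def)

text \<open>
  Brackets of \<open>L\<^sub>\<infinity>\<close>-algebras are required to be skew-symmetric and Lie brackets to be alternating;
  the passage between the two structures rests on these being the same.
\<close>

lemma bilinear_map_skew_iff_alternating: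
  assumes bil: "bilinear_map s s s (f :: 'a::ab_group_add \<Rightarrow> 'a \<Rightarrow> 'a)"
    and vs: "vector_space (s :: 'k::field_char_0 \<Rightarrow> 'a \<Rightarrow> 'a)"
  shows "(\<forall>x y. f x y = - f y x) \<longleftrightarrow> (\<forall>x. f x x = 0)"
proof (intro iffI allI)
  fix x
  assume "\<forall>x y. f x y = - f y x"
  then have "f x x + f x x = 0" by (metis add.right_inverse)
  interpret vector_space s by (rule vs)
  \<comment> \<open>in characteristic zero the scalar two is invertible\<close>
  have "s 2 (f x x) = 0"
    using \<open>f x x + f x x = 0\<close> scale_left_distrib[of 1 1 "f x x"] by simp
  then show "f x x = 0" by simp
next
  fix x y
  assume alt: "\<forall>x. f x x = 0"
  have left: "f (u + v) w = f u w + f v w" for u v w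
    using bil by (simp add: bilinear_map_def Vector_Spaces.linear_iff)
  have right: "f u (v + w) = f u v + f u w" for u v w
    using bil by (simp add: bilinear_map_def Vector_Spaces.linear_iff)
  have "f (x + y) (x + y) = f x y + f y x"
    unfolding left right using alt by simp
  then show "f x y = - f y x" using alt by (simp add: eq_neg_iff_add_eq_0)
qed

section \<open>From strict structures to crossed modules\<close>

text \<open>
  All identities on \<open>\<gg>\<^sub>1\<close> are obtained from those of the action by substituting elements of the
  image of \<open>d\<close>, moving \<open>d\<close> through brackets with \<open>L4\<close>.
\<close>

lemma averaging_crossed_module_of_strict:
  assumes "two_term_averaging_L_infinity s1 s0 d l00 l01 l10 l11 (\<lambda>_ _ _. 0) P0 P1 (\<lambda>_ _. 0)"
  shows "averaging_crossed_module s1 s0 (\<lambda>h k. l01 (d h) k) P1 l00 P0 d l01"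
proof -
  interpret L: two_term_averaging_L_infinity s1 s0 d l00 l01 l10 l11 "\<lambda>_ _ _. 0" P0 P1 "\<lambda>_ _. 0"
    by (rule assms)
  have vs1: "vector_space s1" and vs0: "vector_space s0" by unfold_locales
  have l10: "l10 h x = - l01 x h" for h x using L.L2[of x h] by simp
  have action: "l01 (l00 x y) h = l01 x (l01 y h) - l01 y (l01 x h)" for x y h
    using L.L7[of x y h] by (simp add: l10 bilinear_map_minus_right[OF L.bilinear_l01])
  have average: "l01 (P0 x) (P1 h) = P1 (l01 (P0 x) h)" for x h
    using L.A3(1)[of x h] by simp
  have average': "P1 (l01 (P0 x) h) = P1 (l01 x (P1 h))" for x h
    using L.A3(2)[of x h] by simp
  have dP: "d (P1 h) = P0 (d h)" for h using L.A1 by (metis comp_apply)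

  have lie0: "lie_algebra s0 l00"
  proof (intro lie_algebra.intro lie_algebra_axioms.intro)
    show "l00 x x = 0" for x
      using bilinear_map_skew_iff_alternating[OF L.bilinear_l00 vs0] L.L1 by blast
    show "l00 x (l00 y z) + l00 y (l00 z x) + l00 z (l00 x y) = 0" for x y z
      using L.L6[of x y z] linear_image_zero[OF L.linear_d] by simp
  qed (rule vs0 L.bilinear_l00)+
  have avg0: "averaging_lie_algebra s0 l00 P0"
  proof (intro averaging_lie_algebra.intro averaging_lie_algebra_axioms.intro)
    show "l00 (P0 x) (P0 y) = P0 (l00 (P0 x) y)" for x y
      using L.A2[of x y] linear_image_zero[OF L.linear_d] by simp
  qed (rule lie0 L.linear_P0)+

  have bil1: "bilinear_map s1 s1 s1 (\<lambda>h k. l01 (d h) k)"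
    by (rule bilinear_map_compose_left[OF L.bilinear_l01 L.linear_d])
  have skew1: "l01 (d h) k = - l01 (d k) h" for h k
    using L.L5[of h k] by (simp add: l10)
  have lie1: "lie_algebra s1 (\<lambda>h k. l01 (d h) k)"
  proof (intro lie_algebra.intro lie_algebra_axioms.intro)
    show "l01 (d h) h = 0" for h
      using bilinear_map_skew_iff_alternating[OF bil1 vs1] skew1 by blast
    show "l01 (d h) (l01 (d k) m) + l01 (d k) (l01 (d m) h) + l01 (d m) (l01 (d h) k) = 0"
      for h k m
    proof -
      have "l01 (d m) (l01 (d h) k) = - l01 (l00 (d h) (d k)) m"
        using skew1[of m "l01 (d h) k"] by (simp add: L.L4)
      moreover have "l01 (d k) (l01 (d m) h) = - l01 (d k) (l01 (d h) m)"
        by (subst skew1[of m h]) (rule bilinear_map_minus_right[OF L.bilinear_l01])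
      ultimately show ?thesis by (simp add: action)
    qed
  qed (rule vs1 bil1)+
  have avg1: "averaging_lie_algebra s1 (\<lambda>h k. l01 (d h) k) P1"
    by (intro averaging_lie_algebra.intro averaging_lie_algebra_axioms.intro lie1 L.linear_P1)
      (simp add: dP average)

  have hom: "averaging_lie_algebra_hom s1 (\<lambda>h k. l01 (d h) k) P1 s0 l00 P0 d"
    by (intro averaging_lie_algebra_hom.intro averaging_lie_algebra_hom_axioms.intro
        avg0 avg1 L.linear_d L.A1 L.L4)
  have rep: "averaging_representation s0 l00 P0 s1 l01 P1"
    by (intro averaging_representation.intro averaging_representation_axioms.intro
        lie_algebra_representation.intro lie_algebra_representation_axioms.intro
        avg0 lie0 vs1 L.bilinear_l01 action L.linear_P1 average average')
  have der: "lie_derivation s1 (\<lambda>h k. l01 (d h) k) (l01 x)" for x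
    using L.bilinear_l01 by (simp add: lie_derivation_def bilinear_map_def L.L4 action)
  show ?thesis
    by (intro averaging_crossed_module.intro averaging_crossed_module_axioms.intro
        hom rep der L.L4 refl)
qed

section \<open>From crossed modules to strict structures\<close>

definition strict_L_infinity_of ::
  "('a::ab_group_add, 'b) crossed_module_data \<Rightarrow> ('a, 'b) two_term_data"
  where "strict_L_infinity_of X =
    \<lparr> tt_diff = cm_diff X,
      tt_bracket00 = cm_bracket0 X,
      tt_bracket01 = cm_action X,
      tt_bracket10 = (\<lambda>h x. - cm_action X x h),
      tt_bracket11 = (\<lambda>_ _. 0),
      tt_l3 = (\<lambda>_ _ _. 0),
      tt_avg0 = cm_avg0 X,
      tt_avg1 = cm_avg1 X,
      tt_avg2 = (\<lambda>_ _. 0) \<rparr>"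

text \<open>
  Since the Peiffer identity replaces the bracket of \<open>\<gg>\<^sub>1\<close> by \<open>\<rho> (d h) k\<close>, its skew-symmetry
  becomes \<open>L5\<close>; every other axiom is read off from \<open>\<gg>\<^sub>0\<close>, \<open>d\<close> and the representation \<open>\<rho>\<close>.
\<close>

lemma strict_L_infinity_of_averaging_crossed_module:
  assumes "averaging_crossed_module s1 s0 b1 P1 b0 P0 d \<rho>"
  shows "two_term_averaging_L_infinity s1 s0 d b0 \<rho> (\<lambda>h x. - \<rho> x h) (\<lambda>_ _. 0) (\<lambda>_ _ _. 0)
    P0 P1 (\<lambda>_ _. 0)"
proof -
  interpret X: averaging_crossed_module s1 s0 b1 P1 b0 P0 d \<rho> by (rule assms)
  have vs1: "vector_space s1" and vs0: "vector_space s0" by unfold_locales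
  have d0: "d 0 = 0" by (rule linear_image_zero[OF X.d.linear_hom])
  have P10: "P1 0 = 0" by (rule linear_image_zero[OF X.\<rho>.linear_Q])
  have \<rho>0: "\<rho> x 0 = 0" for x by (rule bilinear_map_zero_right[OF X.\<rho>.bilinear_action])
  have skew0: "b0 x y = - b0 y x" for x y
    using bilinear_map_skew_iff_alternating[OF X.d.target.bilinear vs0] X.d.target.alternating by blast
  have skew1: "b1 h k = - b1 k h" for h k
    using bilinear_map_skew_iff_alternating[OF X.d.source.bilinear vs1] X.d.source.alternating
    by blast
  show ?thesis
  proof (intro two_term_averaging_L_infinity.intro two_term_averaging_L_infinity_axioms.intro
      two_term_L_infinity.intro two_term_L_infinity_axioms.intro)
    show "bilinear_map s1 s0 s1 (\<lambda>h x. - \<rho> x h)"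
      by (rule bilinear_map_uminus_flip[OF X.\<rho>.bilinear_action])
    show "bilinear_map s1 s1 s1 (\<lambda>_ _. 0)" "bilinear_map s0 s0 s1 (\<lambda>_ _. 0)"
      by (simp_all add: bilinear_map_zero_map vs0 vs1)
    show "trilinear_map s0 s1 (\<lambda>_ _ _. 0)"
      by (simp add: trilinear_map_def linear_zero_map vs0 vs1)
    show "b0 x y = - b0 y x" for x y by (rule skew0)
    show "\<rho> (d h) k = - \<rho> (d k) h" for h k
      unfolding X.peiffer by (rule skew1)
    show "d 0 = b0 x (b0 y z) + b0 y (b0 z x) + b0 z (b0 x y)" for x y z
      by (simp add: d0 X.d.target.jacobi)
    show "0 = \<rho> x (\<rho> y h) + \<rho> y (- \<rho> x h) + - \<rho> (b0 x y) h" for x y h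
      by (simp add: X.\<rho>.action_bracket bilinear_map_minus_right[OF X.\<rho>.bilinear_action])
    show "d 0 = P0 (b0 (P0 x) y) - b0 (P0 x) (P0 y)" for x y
      by (simp add: d0 X.d.target.averaging)
    show "0 = P1 (\<rho> (P0 x) h) - \<rho> (P0 x) (P1 h)" for x h
      by (simp add: X.\<rho>.averaging_action1)
    show "P1 (\<rho> (P0 x) h) - \<rho> (P0 x) (P1 h) = P1 (\<rho> x (P1 h)) - \<rho> (P0 x) (P1 h)" for x h
      by (simp add: X.\<rho>.averaging_action2)
  qed (simp_all add: vs0 vs1 X.d.linear_hom X.d.target.bilinear X.\<rho>.bilinear_action
      X.equivariance X.d.target.linear_P X.\<rho>.linear_Q X.d.commute \<rho>0 P10)
qed

section \<open>The correspondence\<close>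

lemma strict_L_infinity_of_crossed_module_of:
  assumes "is_two_term_averaging_L_infinity s1 s0 L" "strict L"
  shows "strict_L_infinity_of (crossed_module_of L) = L"
proof -
  interpret L: two_term_averaging_L_infinity s1 s0 "tt_diff L" "tt_bracket00 L" "tt_bracket01 L"
    "tt_bracket10 L" "tt_bracket11 L" "tt_l3 L" "tt_avg0 L" "tt_avg1 L" "tt_avg2 L"
    using assms(1) by (simp add: is_two_term_averaging_L_infinity_def)
  show ?thesis
    using assms(2) L.L2 L.L3
    by (intro two_term_data.equality)
      (simp_all add: strict_L_infinity_of_def crossed_module_of_def strict_def fun_eq_iff)
qed

lemma crossed_module_of_strict_L_infinity_of:
  assumes "is_averaging_crossed_module s1 s0 X"
  shows "crossed_module_of (strict_L_infinity_of X) = X"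
proof -
  interpret X: averaging_crossed_module s1 s0 "cm_bracket1 X" "cm_avg1 X" "cm_bracket0 X"
    "cm_avg0 X" "cm_diff X" "cm_action X"
    using assms by (simp add: is_averaging_crossed_module_def)
  show ?thesis
    by (simp add: strict_L_infinity_of_def crossed_module_of_def X.peiffer)
qed

theorem theorem3p8:
  fixes s1 :: "'k::field_char_0 \<Rightarrow> 'a::ab_group_add \<Rightarrow> 'a"
    and s0 :: "'k \<Rightarrow> 'b::ab_group_add \<Rightarrow> 'b"
  assumes "vector_space s1" and "vector_space s0"
  shows "bij_betw crossed_module_of
    {L. is_two_term_averaging_L_infinity s1 s0 L \<and> strict L}
    {X. is_averaging_crossed_module s1 s0 X}"
proof (rule bij_betw_byWitness[where f' = strict_L_infinity_of])
  show "crossed_module_of ` {L. is_two_term_averaging_L_infinity s1 s0 L \<and> strict L}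
      \<subseteq> {X. is_averaging_crossed_module s1 s0 X}"
  proof clarify
    fix L :: "('a, 'b) two_term_data"
    assume L: "is_two_term_averaging_L_infinity s1 s0 L" and "strict L"
    then have "tt_l3 L = (\<lambda>_ _ _. 0)" "tt_avg2 L = (\<lambda>_ _. 0)"
      by (simp_all add: strict_def fun_eq_iff)
    with L show "is_averaging_crossed_module s1 s0 (crossed_module_of L)"
      by (simp add: is_two_term_averaging_L_infinity_def is_averaging_crossed_module_def
          crossed_module_of_def averaging_crossed_module_of_strict)
  qed
  show "strict_L_infinity_of ` {X. is_averaging_crossed_module s1 s0 X}
      \<subseteq> {L. is_two_term_averaging_L_infinity s1 s0 L \<and> strict L}"
    by (auto simp: is_two_term_averaging_L_infinity_def is_averaging_crossed_module_def
        strict_L_infinity_of_def strict_def intro: strict_L_infinity_of_averaging_crossed_module)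
qed (auto simp: strict_L_infinity_of_crossed_module_of crossed_module_of_strict_L_infinity_of)

end
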